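(* Let $\sigma\in A^u$. For all $P,Q\in SP_\sigma$, $\mathrm{EqSSCL}\vdash P=Q$ if and only if $P=^{\mathcal S}_{sse,\sigma}Q$.
   Context: $A$ is a non-empty set of atoms. $A^u$ is the set of finite strings over $A$ in which each atom occurs at most once; $\epsilon$ is the empty string. $SP_\sigma$ is the set of closed terms $P::=a\mid\mathsf T\mid\mathsf F\mid\neg P\mid P\land_s P\mid P\lor_s P$ with all atoms occurring in $\sigma$ ($\land_s,\lor_s$ sequential conjunction/disjunction). $\mathrm{EqSSCL}$ consists of (Neg) $\mathsf F=\neg\mathsf T$, (Or) $x\lor_s y=\neg(\neg x\land_s\neg y)$, (Tand) $\mathsf T\land_s x=x$, (Abs) $x\land_s(x\lor_s y)=x$, (Mem) $(x\lor_s y)\land_s z=(\neg x\land_s(y\land_s z))\lor_s(x\land_s z)$, (Comm) $x\land_s y=y\land_s x$; $\vdash$ is equational-logic derivability. Evaluation trees $\mathcal T_A$: generated by $\mathsf T,\mathsf F$ and $X\unlhd a\unrhd Y$ ($a\in A$; root $a$, left branch $X$, right branch $Y$); $X[\mathsf T\mapsto Y,\mathsf F\mapsto Z]$ replaces $\mathsf T$-leaves by $Y$ and $\mathsf F$-leaves by $Z$. For closed terms over $\{\lhd\rhd,\mathsf T,\mathsf F\}\cup A$ (Hoare's conditional $x\lhd y\rhd z$, "if $y$ then $x$ else $z$"): $se(\mathsf T)=\mathsf T$, $se(\mathsf F)=\mathsf F$, $se(a)=\mathsf T\unlhd a\unrhd\mathsf F$, $se(P\lhd Q\rhd R)=se(Q)[\mathsf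 T\mapsto se(P),\mathsf F\mapsto se(R)]$. $m:\mathcal T_A\to\mathcal T_A$: $m(\mathsf T)=\mathsf T$, $m(\mathsf F)=\mathsf F$, $m(X\unlhd a\unrhd Y)=m(L_a(X))\unlhd a\unrhd m(R_a(Y))$, where $L_a,R_a$ fix $\mathsf T,\mathsf F$, $L_a(X\unlhd b\unrhd Y)=L_a(X)$ if $b=a$ and $L_a(X)\unlhd b\unrhd L_a(Y)$ otherwise, $R_a(X\unlhd b\unrhd Y)=R_a(Y)$ if $b=a$ and $R_a(X)\unlhd b\unrhd R_a(Y)$ otherwise. $\mathit{mse}^{\mathcal C}(P)=m(se(P))$. Let $E_\epsilon=\mathsf F$, $E_{a\rho}=E_\rho\lhd a\rhd E_\rho$, and $sse^{\mathcal C}_\sigma(P)=\mathit{mse}^{\mathcal C}(\mathsf T\lhd E_\sigma\rhd P)$. The translation $f$: $f(\mathsf T)=\mathsf T$, $f(\mathsf F)=\mathsf F$, $f(a)=a$, $f(\neg t)=\mathsf F\lhd f(t)\rhd\mathsf T$, $f(t_1\land_s t_2)=f(t_2)\lhd f(t_1)\rhd\mathsf F$, $f(t_1\lor_s t_2)=\mathsf T\lhd f(t_1)\rhd f(t_2)$. For $P,Q\in SP_\sigma$, $P=^{\mathcal S}_{sse,\sigma}Q$ iff $sse^{\mathcal C}_\sigma(f(P))=sse^{\mathcal C}_\sigma(f(Q))$. *)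

theory Defs
  imports Main
begin

section \<open>Terms of short-circuit logic\<close>

text \<open>The set of atoms is the (necessarily non-empty) type \<open>'a\<close>. Terms may contain
  variables, which the axioms and the equational derivations need.\<close>

datatype 'a sterm =
    Var nat
  | Atom 'a
  | STrue  ("\<^bold>T")
  | SFalse  ("\<^bold>F")
  | SNot "'a sterm"  ("\<^bold>\<not> _" [80] 80)
  | SAnd "'a sterm" "'a sterm"  (infixr "\<and>s" 75)
  | SOr "'a sterm" "'a sterm"  (infixr "\<or>s" 70)

inductive_set SP :: "'a list \<Rightarrow> 'a sterm set" for \<sigma> :: "'a list" where
  SP_Atom: "a \<in> set \<sigma> \<Longrightarrow> Atom a \<in> SP \<sigma>"
| SP_True: "\<^bold>T \<in> SP \<sigma>"
| SP_False: "\<^bold>F \<in> SP \<sigma>"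
| SP_Not: "P \<in> SP \<sigma> \<Longrightarrow> \<^bold>\<not> P \<in> SP \<sigma>"
| SP_And: "P \<in> SP \<sigma> \<Longrightarrow> Q \<in> SP \<sigma> \<Longrightarrow> P \<and>s Q \<in> SP \<sigma>"
| SP_Or: "P \<in> SP \<sigma> \<Longrightarrow> Q \<in> SP \<sigma> \<Longrightarrow> P \<or>s Q \<in> SP \<sigma>"


section \<open>Equational logic and the axioms EqSSCL\<close>

primrec subst :: "(nat \<Rightarrow> 'a sterm) \<Rightarrow> 'a sterm \<Rightarrow> 'a sterm" where
  "subst \<theta> (Var v) = \<theta> v"
| "subst \<theta> (Atom a) = Atom a"
| "subst \<theta> \<^bold>T = \<^bold>T"
| "subst \<theta> \<^bold>F = \<^bold>F"
| "subst \<theta> (\<^bold>\<not> s) = \<^bold>\<not> (subst \<theta> s)"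
| "subst \<theta> (s \<and>s t) = subst \<theta> s \<and>s subst \<theta> t"
| "subst \<theta> (s \<or>s t) = subst \<theta> s \<or>s subst \<theta> t"

inductive derivable :: "('a sterm \<times> 'a sterm) set \<Rightarrow> 'a sterm \<Rightarrow> 'a sterm \<Rightarrow> bool"
    ("_ \<turnstile> _ \<approx> _" [51, 51, 51] 50)
  for E :: "('a sterm \<times> 'a sterm) set" where
  ax: "(s, t) \<in> E \<Longrightarrow> E \<turnstile> s \<approx> t"
| refl: "E \<turnstile> s \<approx> s"
| sym: "E \<turnstile> s \<approx> t \<Longrightarrow> E \<turnstile> t \<approx> s"
| trans: "E \<turnstile> s \<approx> t \<Longrightarrow> E \<turnstile> t \<approx> u \<Longrightarrow> E \<turnstile> s \<approx> u"
| inst: "E \<turnstile> s \<approx> t \<Longrightarrow> E \<turnstile> subst \<theta> s \<approx> subst \<theta> t"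
| cong_Not: "E \<turnstile> s \<approx> t \<Longrightarrow> E \<turnstile> \<^bold>\<not> s \<approx> \<^bold>\<not> t"
| cong_And: "E \<turnstile> s \<approx> s' \<Longrightarrow> E \<turnstile> t \<approx> t' \<Longrightarrow> E \<turnstile> s \<and>s t \<approx> s' \<and>s t'"
| cong_Or: "E \<turnstile> s \<approx> s' \<Longrightarrow> E \<turnstile> t \<approx> t' \<Longrightarrow> E \<turnstile> s \<or>s t \<approx> s' \<or>s t'"

text \<open>The axioms are, in order, Neg, Or, Tand, Abs, Mem and Comm.\<close>

definition EqSSCL :: "('a sterm \<times> 'a sterm) set" where
  "EqSSCL = (let x = Var 0; y = Var 1; z = Var 2 in
    {(\<^bold>F, \<^bold>\<not> \<^bold>T),
     (x \<or>s y, \<^bold>\<not> (\<^bold>\<not> x \<and>s \<^bold>\<not> y)),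
     (\<^bold>T \<and>s x, x),
     (x \<and>s (x \<or>s y), x),
     ((x \<or>s y) \<and>s z, (\<^bold>\<not> x \<and>s (y \<and>s z)) \<or>s (x \<and>s z)),
     (x \<and>s y, y \<and>s x)})"


section \<open>Evaluation trees\<close>

text \<open>In \<open>X \<unlhd> a \<unrhd> Y\<close> the left branch \<open>X\<close> is taken if \<open>a\<close> evaluates to true.\<close>

datatype 'a etree =
    TLeaf
  | FLeaf
  | Node "'a etree" 'a "'a etree"  ("_ \<unlhd> _ \<unrhd> _" [61, 61, 61] 60)

text \<open>\<open>replace_leaves X Y Z\<close> is \<open>X[T \<mapsto> Y, F \<mapsto> Z]\<close>.\<close>

primrec replace_leaves :: "'a etree \<Rightarrow> 'a etree \<Rightarrow> 'a etree \<Rightarrow> 'a etree" where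
  "replace_leaves TLeaf Y Z = Y"
| "replace_leaves FLeaf Y Z = Z"
| "replace_leaves (X1 \<unlhd> a \<unrhd> X2) Y Z = replace_leaves X1 Y Z \<unlhd> a \<unrhd> replace_leaves X2 Y Z"

primrec Lred :: "'a \<Rightarrow> 'a etree \<Rightarrow> 'a etree" where
  "Lred a TLeaf = TLeaf"
| "Lred a FLeaf = FLeaf"
| "Lred a (X \<unlhd> b \<unrhd> Y) = (if b = a then Lred a X else Lred a X \<unlhd> b \<unrhd> Lred a Y)"

primrec Rred :: "'a \<Rightarrow> 'a etree \<Rightarrow> 'a etree" where
  "Rred a TLeaf = TLeaf"
| "Rred a FLeaf = FLeaf"
| "Rred a (X \<unlhd> b \<unrhd> Y) = (if b = a then Rred a Y else Rred a X \<unlhd> b \<unrhd> Rred a Y)"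

lemma size_Lred [termination_simp]: "size (Lred a X) \<le> size X"
  by (induction X) auto

lemma size_Rred [termination_simp]: "size (Rred a X) \<le> size X"
  by (induction X) auto

text \<open>The memorising map \<open>m\<close>; \<open>Lred\<close> and \<open>Rred\<close> are \<open>L\<^sub>a\<close> and \<open>R\<^sub>a\<close>.\<close>

fun memo :: "'a etree \<Rightarrow> 'a etree" where
  "memo TLeaf = TLeaf"
| "memo FLeaf = FLeaf"
| "memo (X \<unlhd> a \<unrhd> Y) = memo (Lred a X) \<unlhd> a \<unrhd> memo (Rred a Y)"


section \<open>Closed conditional terms and their evaluation\<close>

text \<open>\<open>x \<lhd> y \<rhd> z\<close> is Hoare's conditional: if \<open>y\<close> then \<open>x\<close> else \<open>z\<close>.\<close>

datatype 'a cterm =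
    CTrue
  | CFalse
  | CAtom 'a
  | Cond "'a cterm" "'a cterm" "'a cterm"  ("_ \<lhd> _ \<rhd> _" [61, 61, 61] 60)

primrec se :: "'a cterm \<Rightarrow> 'a etree" where
  "se CTrue = TLeaf"
| "se CFalse = FLeaf"
| "se (CAtom a) = TLeaf \<unlhd> a \<unrhd> FLeaf"
| "se (P \<lhd> Q \<rhd> R) = replace_leaves (se Q) (se P) (se R)"

definition mse :: "'a cterm \<Rightarrow> 'a etree" where
  "mse P = memo (se P)"

primrec E_term :: "'a list \<Rightarrow> 'a cterm" where
  "E_term [] = CFalse"
| "E_term (a # \<rho>) = E_term \<rho> \<lhd> CAtom a \<rhd> E_term \<rho>"

definition sse :: "'a list \<Rightarrow> 'a cterm \<Rightarrow> 'a etree" where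
  "sse \<sigma> P = mse (CTrue \<lhd> E_term \<sigma> \<rhd> P)"


section \<open>Static evaluation congruence\<close>

text \<open>\<open>transl\<close> is the translation \<open>f\<close>. It is only needed on closed terms, so its
  value on variables is left unspecified.\<close>

primrec (nonexhaustive) transl :: "'a sterm \<Rightarrow> 'a cterm" where
  "transl \<^bold>T = CTrue"
| "transl \<^bold>F = CFalse"
| "transl (Atom a) = CAtom a"
| "transl (\<^bold>\<not> t) = CFalse \<lhd> transl t \<rhd> CTrue"
| "transl (t1 \<and>s t2) = transl t2 \<lhd> transl t1 \<rhd> CFalse"
| "transl (t1 \<or>s t2) = CTrue \<lhd> transl t1 \<rhd> transl t2"

definition sse_eq :: "'a list \<Rightarrow> 'a sterm \<Rightarrow> 'a sterm \<Rightarrow> bool" where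
  "sse_eq \<sigma> P Q \<longleftrightarrow> sse \<sigma> (transl P) = sse \<sigma> (transl Q)"

end

theory Submission
  imports Defs
begin

text \<open>Both sides of the equivalence say that \<open>P\<close> and \<open>Q\<close> have the same truth table. Evaluating
  \<open>E\<^sub>\<sigma>\<close> first and memorising the answers yields the complete binary decision tree over \<open>\<sigma>\<close>, whose
  leaves record the truth table. On the other side, the axioms entail those of Boolean algebra, so in
  the algebra of terms modulo derivability the meet of a minterm over \<open>\<sigma>\<close> with the class of \<open>P\<close> is
  the minterm itself or zero, as the truth table dictates, and elements of a Boolean algebra are
  determined by their meets with all minterms.\<close>

section \<open>Boolean algebra laws from the axioms\<close>

text \<open>The axioms are stated for an abstract algebra, so that derivations become reasoning with
  equality; the quotient of terms by derivability is the intended instance.\<close>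

locale sscl_algebra =
  fixes neg :: "'b \<Rightarrow> 'b" ("\<sim> _" [80] 80)
    and conj :: "'b \<Rightarrow> 'b \<Rightarrow> 'b" (infixr "\<sqinter>" 75)
    and disj :: "'b \<Rightarrow> 'b \<Rightarrow> 'b" (infixr "\<squnion>" 70)
    and one :: 'b ("\<top>")
    and zero :: 'b ("\<bottom>")
  assumes Neg: "\<bottom> = \<sim> \<top>"
    and Or: "x \<squnion> y = \<sim> (\<sim> x \<sqinter> \<sim> y)"
    and Tand: "\<top> \<sqinter> x = x"
    and Abs: "x \<sqinter> (x \<squnion> y) = x"
    and Mem: "(x \<squnion> y) \<sqinter> z = (\<sim> x \<sqinter> (y \<sqinter> z)) \<squnion> (x \<sqinter> z)"
    and Comm: "x \<sqinter> y = y \<sqinter> x"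
begin

lemma disj_commute: "x \<squnion> y = y \<squnion> x"
  by (metis Or Comm)

text \<open>\<open>Abs\<close> at \<open>\<top>\<close> gives
  \<open>\<top> \<squnion> x = \<top>\<close>; then \<open>Mem\<close> with both \<open>y\<close>
  and \<open>z\<close> equal to \<open>\<top>\<close> is the claim up to commutativity.\<close>

lemma disj_neg: "x \<squnion> \<sim> x = \<top>"
  by (metis Abs Tand Comm Mem disj_commute)

lemma conj_neg: "x \<sqinter> \<sim> x = \<bottom>"
  using Neg Or Tand Abs Mem Comm disj_commute disj_neg by metis

lemma conj_idem: "x \<sqinter> x = x"
  using Neg Or Tand Abs Mem Comm disj_commute disj_neg by metis

lemma neg_neg: "\<sim> \<sim> x = x"
proof -
  have split: "z = (\<sim> x \<sqinter> (\<sim> x \<sqinter> z)) \<squnion> (x \<sqinter> z)" for z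
    by (metis Mem disj_neg Tand)
  have "x \<sqinter> \<sim> \<sim> x = x"
    by (metis Abs Or conj_idem)
  \<comment> \<open>Both instances of \<open>split\<close> have right-hand side
    \<open>(\<sim> x \<sqinter> \<bottom>) \<squnion> x\<close>; the value of
    \<open>\<sim> x \<sqinter> \<bottom>\<close> need not be known.\<close>
  then show ?thesis
    using split[of "\<sim> \<sim> x"] split[of x] by (metis conj_neg Comm conj_idem)
qed

lemma conj_zero: "x \<sqinter> \<bottom> = \<bottom>"
  by (metis Abs Neg Or Tand Comm neg_neg)

lemma zero_conj: "\<bottom> \<sqinter> x = \<bottom>"
  by (metis Comm conj_zero)

lemma conj_one: "x \<sqinter> \<top> = x"
  by (metis Comm Tand)

lemma disj_zero: "x \<squnion> \<bottom> = x"
  by (metis Neg Or Tand Comm neg_neg)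

lemma zero_disj: "\<bottom> \<squnion> x = x"
  by (metis disj_commute disj_zero)

lemma disj_idem: "x \<squnion> x = x"
  by (simp add: Or conj_idem neg_neg)

lemma neg_conj: "\<sim> (x \<sqinter> y) = \<sim> x \<squnion> \<sim> y"
  by (simp add: Or neg_neg)

lemma neg_disj: "\<sim> (x \<squnion> y) = \<sim> x \<sqinter> \<sim> y"
  by (simp add: Or neg_neg)

text \<open>This is \<open>Mem\<close> with \<open>z\<close> equal to \<open>\<top>\<close>.\<close>

lemma disj_absorb_neg: "x \<squnion> (\<sim> x \<sqinter> y) = x \<squnion> y"
  by (metis Mem Tand Comm disj_commute)

lemma conj_absorb_neg: "x \<sqinter> (\<sim> x \<squnion> y) = x \<sqinter> y"
  by (metis disj_absorb_neg neg_conj neg_disj neg_neg)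

lemma disj_absorb: "x \<squnion> (x \<sqinter> y) = x"
  by (metis Abs neg_conj neg_disj neg_neg)

lemma conj_left_idem: "x \<sqinter> (x \<sqinter> y) = x \<sqinter> y"
proof -
  have "x \<sqinter> y = (\<sim> x \<squnion> y) \<sqinter> x"
    by (metis conj_absorb_neg Comm)
  also have "\<dots> = (x \<sqinter> (y \<sqinter> x)) \<squnion> (\<sim> x \<sqinter> x)"
    by (metis Mem neg_neg)
  also have "\<dots> = x \<sqinter> (x \<sqinter> y)"
    by (metis Comm conj_neg disj_zero)
  finally show ?thesis ..
qed

text \<open>For \<open>u = x \<sqinter> y\<close>, absorption gives
  \<open>\<sim> u \<squnion> \<sim> x = \<sim> u\<close>, so \<open>conj_absorb_neg\<close> turns
  \<open>u \<sqinter> \<sim> x\<close> into \<open>u \<sqinter> \<sim> u\<close>.\<close>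

lemma conj_neg_left: "\<sim> x \<sqinter> (x \<sqinter> y) = \<bottom>"
  by (metis disj_absorb neg_disj conj_neg conj_absorb_neg neg_neg neg_conj Comm)

text \<open>\<open>Mem\<close> is distributivity with an extra factor \<open>\<sim> x\<close> on
  \<open>y \<sqinter> z\<close>. By \<open>disj_absorb_neg\<close> a factor
  \<open>\<sim> (x \<sqinter> z)\<close> may be put there freely, and it acts on
  \<open>y \<sqinter> z\<close> just as \<open>\<sim> x\<close> does.\<close>

lemma conj_disj_distrib_right: "(x \<squnion> y) \<sqinter> z = (x \<sqinter> z) \<squnion> (y \<sqinter> z)"
proof -
  have "(\<sim> x \<squnion> \<sim> z) \<sqinter> (y \<sqinter> z) = (x \<sqinter> (\<sim> z \<sqinter> (y \<sqinter> z))) \<squnion> (\<sim> x \<sqinter> (y \<sqinter> z))"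
    by (metis Mem neg_neg)
  also have "\<dots> = \<sim> x \<sqinter> (y \<sqinter> z)"
    by (metis conj_neg_left conj_zero disj_zero disj_commute Comm)
  finally have "(x \<sqinter> z) \<squnion> (y \<sqinter> z) = (x \<sqinter> z) \<squnion> (\<sim> x \<sqinter> (y \<sqinter> z))"
    by (metis disj_absorb_neg neg_conj)
  then show ?thesis
    by (metis Mem disj_commute)
qed

lemma conj_neg_if_below: "x \<sqinter> y = x \<Longrightarrow> x \<sqinter> \<sim> y = \<bottom>"
  by (metis conj_neg_left Comm)

lemma conj_neg_if_disjoint: "x \<sqinter> y = \<bottom> \<Longrightarrow> x \<sqinter> \<sim> y = x"
  by (metis disj_zero conj_disj_distrib_right disj_neg Tand Comm disj_commute)

lemma conj_disj_distrib: "x \<sqinter> (y \<squnion> z) = (x \<sqinter> y) \<squnion> (x \<sqinter> z)"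
  by (metis conj_disj_distrib_right Comm)

lemma disj_conj_distrib: "x \<squnion> (y \<sqinter> z) = (x \<squnion> y) \<sqinter> (x \<squnion> z)"
  by (metis conj_disj_distrib neg_conj neg_disj neg_neg)

text \<open>The meet of \<open>x \<squnion> y\<close> and \<open>\<sim> x \<squnion> y\<close> is
  \<open>y\<close>.\<close>

lemma disj_cases: "\<lbrakk>x \<squnion> y = x \<squnion> z; \<sim> x \<squnion> y = \<sim> x \<squnion> z\<rbrakk> \<Longrightarrow> y = z"
  by (metis disj_conj_distrib disj_commute conj_neg disj_zero)

text \<open>Joined with \<open>x\<close>, both sides collapse to \<open>x\<close>; joined with
  \<open>\<sim> x\<close>, both become
  \<open>(\<sim> x \<squnion> y) \<sqinter> (\<sim> x \<squnion> z)\<close>.\<close>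

lemma conj_assoc: "(x \<sqinter> y) \<sqinter> z = x \<sqinter> (y \<sqinter> z)"
proof (rule disj_cases[of x])
  show "x \<squnion> ((x \<sqinter> y) \<sqinter> z) = x \<squnion> (x \<sqinter> (y \<sqinter> z))"
    by (metis Abs disj_absorb disj_conj_distrib)
  show "\<sim> x \<squnion> ((x \<sqinter> y) \<sqinter> z) = \<sim> x \<squnion> (x \<sqinter> (y \<sqinter> z))"
    by (metis disj_absorb_neg disj_conj_distrib neg_neg)
qed

end

section \<open>Minterms\<close>

text \<open>Variables get values too, because a derivation between closed terms may pass through
  open ones.\<close>

primrec eval :: "(nat \<Rightarrow> bool) \<Rightarrow> ('a \<Rightarrow> bool) \<Rightarrow> 'a sterm \<Rightarrow> bool" where
  "eval w v (Var n) = w n"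
| "eval w v (Atom a) = v a"
| "eval w v \<^bold>T = True"
| "eval w v \<^bold>F = False"
| "eval w v (\<^bold>\<not> t) = (\<not> eval w v t)"
| "eval w v (s \<and>s t) = (eval w v s \<and> eval w v t)"
| "eval w v (s \<or>s t) = (eval w v s \<or> eval w v t)"

locale sscl_model = sscl_algebra neg conj disj one zero
  for neg :: "'b \<Rightarrow> 'b" ("\<sim> _" [80] 80)
    and conj :: "'b \<Rightarrow> 'b \<Rightarrow> 'b" (infixr "\<sqinter>" 75)
    and disj :: "'b \<Rightarrow> 'b \<Rightarrow> 'b" (infixr "\<squnion>" 70)
    and one :: 'b ("\<top>")
    and zero :: 'b ("\<bottom>") +
  fixes h :: "'a sterm \<Rightarrow> 'b"
  assumes h_True: "h \<^bold>T = \<top>"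
    and h_False: "h \<^bold>F = \<bottom>"
    and h_Not: "h (\<^bold>\<not> s) = \<sim> h s"
    and h_And: "h (s \<and>s t) = h s \<sqinter> h t"
    and h_Or: "h (s \<or>s t) = h s \<squnion> h t"
begin

primrec minterm :: "('a \<Rightarrow> bool) \<Rightarrow> 'a list \<Rightarrow> 'b" where
  "minterm v [] = \<top>"
| "minterm v (a # \<rho>) = (if v a then h (Atom a) else \<sim> h (Atom a)) \<sqinter> minterm v \<rho>"

lemma minterm_cong: "(\<And>a. a \<in> set \<rho> \<Longrightarrow> v a = v' a) \<Longrightarrow> minterm v \<rho> = minterm v' \<rho>"
  by (induction \<rho>) auto

lemma minterm_Atom:
  "a \<in> set \<rho> \<Longrightarrow> minterm v \<rho> \<sqinter> h (Atom a) = (if v a then minterm v \<rho> else \<bottom>)"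
proof (induction \<rho>)
  case (Cons b \<rho>)
  show ?case
  proof (cases "a = b")
    case True
    have "(x \<sqinter> y) \<sqinter> x = x \<sqinter> y" "(\<sim> x \<sqinter> y) \<sqinter> x = \<bottom>" for x y
      by (metis Comm conj_left_idem) (metis Comm conj_neg_left neg_neg)
    with True show ?thesis
      by simp
  next
    case False
    with Cons show ?thesis
      by (auto simp: conj_assoc conj_zero)
  qed
qed simp

text \<open>A minterm lies below \<open>h P\<close> or is disjoint from it, and this alternative
  passes through every connective, negation swapping the two cases.\<close>

lemma minterm_conj:
  "P \<in> SP \<sigma> \<Longrightarrow> minterm v \<sigma> \<sqinter> h P = (if eval w v P then minterm v \<sigma> else \<bottom>)"
proof (induction rule: SP.induct)
  case (SP_Not P)
  then show ?case
    by (simp add: h_Not conj_neg_if_below conj_neg_if_disjoint split: if_split_asm)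
next
  case (SP_And P Q)
  then show ?case
    by (auto simp: h_And conj_assoc[symmetric] zero_conj)
next
  case (SP_Or P Q)
  then show ?case
    by (auto simp: h_Or conj_disj_distrib disj_idem disj_zero zero_disj)
qed (auto simp: h_True h_False minterm_Atom conj_zero conj_one)

text \<open>An element is the join of its meets with a literal and with the negated literal, so one
  atom is split off at a time.\<close>

lemma eq_if_minterm_conj_eq:
  assumes "distinct \<rho>" and "\<And>v. minterm v \<rho> \<sqinter> x = minterm v \<rho> \<sqinter> y"
  shows "x = y"
  using assms
proof (induction \<rho> arbitrary: x y)
  case Nil
  then show ?case
    by (simp add: Tand)
next
  case (Cons a \<rho>)
  define l where "l b = (if b then h (Atom a) else \<sim> h (Atom a))" for b
  have "l b \<sqinter> x = l b \<sqinter> y" for b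
  proof (rule Cons.IH)
    fix v
    \<comment> \<open>As \<open>a\<close> is not in \<open>\<rho>\<close>, its sign can be chosen
      independently of the remaining minterm.\<close>
    have "minterm (v(a := b)) \<rho> = minterm v \<rho>"
      using Cons.prems(1) by (intro minterm_cong) auto
    then have "(l b \<sqinter> minterm v \<rho>) \<sqinter> x = (l b \<sqinter> minterm v \<rho>) \<sqinter> y"
      using Cons.prems(2)[of "v(a := b)"]
      by (cases b) (simp_all add: l_def fun_upd_same del: fun_upd_apply)
    then show "minterm v \<rho> \<sqinter> (l b \<sqinter> x) = minterm v \<rho> \<sqinter> (l b \<sqinter> y)"
      by (metis conj_assoc Comm)
  qed (use Cons.prems(1) in simp)
  from this[of True] this[of False] have "h (Atom a) \<sqinter> x = h (Atom a) \<sqinter> y"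
    and "\<sim> h (Atom a) \<sqinter> x = \<sim> h (Atom a) \<sqinter> y"
    by (simp_all add: l_def)
  then show ?case
    by (metis conj_disj_distrib_right disj_neg Tand)
qed

lemma h_eq_if_eval_eq:
  assumes "distinct \<sigma>" "P \<in> SP \<sigma>" "Q \<in> SP \<sigma>" and "\<And>v. eval w v P = eval w v Q"
  shows "h P = h Q"
  by (rule eq_if_minterm_conj_eq[of \<sigma>]) (simp_all add: assms minterm_conj[where w = w])

end

section \<open>Derivability coincides with truth-table equality\<close>

lemma eval_subst: "eval w v (subst \<theta> s) = eval (\<lambda>n. eval w v (\<theta> n)) v s"
  by (induction s) auto

lemma derivable_sound: "EqSSCL \<turnstile> s \<approx> t \<Longrightarrow> eval w v s = eval w v t"
\<comment> \<open>Instantiation by \<open>\<theta>\<close> changes the values of the variables,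
  hence the generalisation over \<open>w\<close>.\<close>
proof (induction arbitrary: w rule: derivable.induct)
  case (ax s t)
  then show ?case
    by (auto simp: EqSSCL_def Let_def)
qed (auto simp: eval_subst)

lemma EqSSCL_instances:
  fixes x y z :: "'a sterm"
  shows "EqSSCL \<turnstile> (\<^bold>F :: 'a sterm) \<approx> \<^bold>\<not> \<^bold>T"
    and "EqSSCL \<turnstile> x \<or>s y \<approx> \<^bold>\<not> (\<^bold>\<not> x \<and>s \<^bold>\<not> y)"
    and "EqSSCL \<turnstile> \<^bold>T \<and>s x \<approx> x"
    and "EqSSCL \<turnstile> x \<and>s (x \<or>s y) \<approx> x"
    and "EqSSCL \<turnstile> (x \<or>s y) \<and>s z \<approx> (\<^bold>\<not> x \<and>s (y \<and>s z)) \<or>s (x \<and>s z)"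
    and "EqSSCL \<turnstile> x \<and>s y \<approx> y \<and>s x"
proof -
  define \<theta> :: "nat \<Rightarrow> 'a sterm" where
    "\<theta> n = (if n = 0 then x else if n = 1 then y else z)" for n
  have *: "EqSSCL \<turnstile> s' \<approx> t'"
    if "(s, t) \<in> EqSSCL" "s' = subst \<theta> s" "t' = subst \<theta> t" for s t s' t'
    using that by (auto intro: derivable.inst derivable.ax)
  show "EqSSCL \<turnstile> (\<^bold>F :: 'a sterm) \<approx> \<^bold>\<not> \<^bold>T"
    by (rule *[where s = "\<^bold>F" and t = "\<^bold>\<not> \<^bold>T"])
      (simp_all add: EqSSCL_def Let_def \<theta>_def)
  show "EqSSCL \<turnstile> x \<or>s y \<approx> \<^bold>\<not> (\<^bold>\<not> x \<and>s \<^bold>\<not> y)"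
    by (rule *[where s = "Var 0 \<or>s Var 1" and t = "\<^bold>\<not> (\<^bold>\<not> Var 0 \<and>s \<^bold>\<not> Var 1)"])
      (simp_all add: EqSSCL_def Let_def \<theta>_def)
  show "EqSSCL \<turnstile> \<^bold>T \<and>s x \<approx> x"
    by (rule *[where s = "\<^bold>T \<and>s Var 0" and t = "Var 0"])
      (simp_all add: EqSSCL_def Let_def \<theta>_def)
  show "EqSSCL \<turnstile> x \<and>s (x \<or>s y) \<approx> x"
    by (rule *[where s = "Var 0 \<and>s (Var 0 \<or>s Var 1)" and t = "Var 0"])
      (simp_all add: EqSSCL_def Let_def \<theta>_def)
  show "EqSSCL \<turnstile> (x \<or>s y) \<and>s z \<approx> (\<^bold>\<not> x \<and>s (y \<and>s z)) \<or>s (x \<and>s z)"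
    by (rule *[where s = "(Var 0 \<or>s Var 1) \<and>s Var 2"
          and t = "(\<^bold>\<not> Var 0 \<and>s (Var 1 \<and>s Var 2)) \<or>s (Var 0 \<and>s Var 2)"])
      (simp_all add: EqSSCL_def Let_def \<theta>_def)
  show "EqSSCL \<turnstile> x \<and>s y \<approx> y \<and>s x"
    by (rule *[where s = "Var 0 \<and>s Var 1" and t = "Var 1 \<and>s Var 0"])
      (simp_all add: EqSSCL_def Let_def \<theta>_def)
qed

\<comment> \<open>In this quotient derivability becomes equality; the congruence rules make the
  connectives well defined on it.\<close>
quotient_type 'a sclass = "'a sterm" / "derivable EqSSCL"
  by (intro equivpI reflpI sympI transpI) (blast intro: derivable.intros)+

lift_definition class_Not :: "'a sclass \<Rightarrow> 'a sclass" is SNot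
  by (rule derivable.cong_Not)

lift_definition class_And :: "'a sclass \<Rightarrow> 'a sclass \<Rightarrow> 'a sclass" is SAnd
  by (rule derivable.cong_And)

lift_definition class_Or :: "'a sclass \<Rightarrow> 'a sclass \<Rightarrow> 'a sclass" is SOr
  by (rule derivable.cong_Or)

lift_definition class_True :: "'a sclass" is STrue .

lift_definition class_False :: "'a sclass" is SFalse .

interpretation sclass: sscl_model class_Not class_And class_Or class_True class_False
  "abs_sclass :: 'a sterm \<Rightarrow> 'a sclass"
proof
  fix x y z :: "'a sclass"
  show "class_False = class_Not class_True"
    by transfer (rule EqSSCL_instances)
  show "class_Or x y = class_Not (class_And (class_Not x) (class_Not y))"
    by transfer (rule EqSSCL_instances)
  show "class_And class_True x = x"
    by transfer (rule EqSSCL_instances)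
  show "class_And x (class_Or x y) = x"
    by transfer (rule EqSSCL_instances)
  show "class_And (class_Or x y) z =
      class_Or (class_And (class_Not x) (class_And y z)) (class_And x z)"
    by transfer (rule EqSSCL_instances)
  show "class_And x y = class_And y x"
    by transfer (rule EqSSCL_instances)
qed (simp_all add: class_Not.abs_eq class_And.abs_eq class_Or.abs_eq class_True_def class_False_def)

lemma derivable_iff_eval_eq:
  assumes "distinct \<sigma>" "P \<in> SP \<sigma>" "Q \<in> SP \<sigma>"
  shows "EqSSCL \<turnstile> P \<approx> Q \<longleftrightarrow> (\<forall>v. eval w v P = eval w v Q)"
proof
  assume "\<forall>v. eval w v P = eval w v Q"
  with assms have "abs_sclass P = abs_sclass Q"
    by (intro sclass.h_eq_if_eval_eq) auto
  then show "EqSSCL \<turnstile> P \<approx> Q"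
    by (simp add: sclass.abs_eq_iff)
qed (simp add: derivable_sound)

section \<open>Static evaluation trees are complete decision trees\<close>

primrec teval :: "('a \<Rightarrow> bool) \<Rightarrow> 'a etree \<Rightarrow> bool" where
  "teval v TLeaf = True"
| "teval v FLeaf = False"
| "teval v (X \<unlhd> a \<unrhd> Y) = (if v a then teval v X else teval v Y)"

lemma teval_replace_leaves:
  "teval v (replace_leaves X Y Z) = (if teval v X then teval v Y else teval v Z)"
  by (induction X) auto

lemma teval_Lred: "v a \<Longrightarrow> teval v (Lred a X) = teval v X"
  by (induction X) auto

lemma teval_Rred: "\<not> v a \<Longrightarrow> teval v (Rred a X) = teval v X"
  by (induction X) auto

text \<open>The left branch of \<open>a\<close> is entered only if \<open>v a\<close> holds, and
  there \<open>Lred a\<close> resolves repeated queries of \<open>a\<close> exactly as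
  \<open>v\<close> would; dually on the right.\<close>

lemma teval_memo: "teval v (memo X) = teval v X"
  by (induction X rule: memo.induct) (auto simp: teval_Lred teval_Rred)

text \<open>Prefixing this term therefore forces the queries of \<open>\<rho>\<close> and then falls
  through to \<open>P\<close>.\<close>

lemma teval_E_term: "\<not> teval v (se (E_term \<rho>))"
  by (induction \<rho>) auto

lemma teval_transl: "P \<in> SP \<sigma> \<Longrightarrow> teval v (se (transl P)) = eval w v P"
  by (induction rule: SP.induct) (auto simp: teval_replace_leaves)

lemma teval_sse: "P \<in> SP \<sigma> \<Longrightarrow> teval v (sse \<rho> (transl P)) = eval w v P"
  by (simp add: sse_def mse_def teval_memo teval_replace_leaves teval_E_term teval_transl)

text \<open>Full decision trees querying the atoms in the fixed order \<open>\<rho>\<close> on every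
  path: a canonical form for truth tables.\<close>

primrec complete :: "'a list \<Rightarrow> 'a etree \<Rightarrow> bool" where
  "complete [] X \<longleftrightarrow> X = TLeaf \<or> X = FLeaf"
| "complete (a # \<rho>) X \<longleftrightarrow> (\<exists>Y Z. X = (Y \<unlhd> a \<unrhd> Z) \<and> complete \<rho> Y \<and> complete \<rho> Z)"

lemma teval_cong: "(\<And>a. a \<in> set_etree X \<Longrightarrow> v a = v' a) \<Longrightarrow> teval v X = teval v' X"
  by (induction X) auto

lemma complete_set_etree: "complete \<rho> X \<Longrightarrow> set_etree X \<subseteq> set \<rho>"
  by (induction \<rho> arbitrary: X) fastforce+

lemma complete_eq_if_teval_eq:
  assumes "distinct \<rho>" "complete \<rho> X" "complete \<rho> Y" and "\<And>v. teval v X = teval v Y"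
  shows "X = Y"
  using assms
proof (induction \<rho> arbitrary: X Y)
  case Nil
  then show ?case
    by (auto 0 3)
next
  case (Cons a \<rho>)
  from Cons.prems obtain X1 X2 Y1 Y2 where
    X: "X = (X1 \<unlhd> a \<unrhd> X2)" "complete \<rho> X1" "complete \<rho> X2" and
    Y: "Y = (Y1 \<unlhd> a \<unrhd> Y2)" "complete \<rho> Y1" "complete \<rho> Y2"
    by auto
  \<comment> \<open>The subtrees do not query \<open>a\<close>, so setting \<open>a\<close> selects
    a branch of the root without affecting its value.\<close>
  have update: "teval (v(a := b)) Z = teval v Z" if "complete \<rho> Z" for v b Z
    using complete_set_etree[OF that] Cons.prems(1) by (intro teval_cong) auto
  have "teval v X1 = teval v Y1" "teval v X2 = teval v Y2" for v
    using Cons.prems(4)[of "v(a := True)"] Cons.prems(4)[of "v(a := False)"]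
    by (simp_all add: X(1) Y(1) update[OF X(2)] update[OF X(3)] update[OF Y(2)] update[OF Y(3)]
        fun_upd_same        del: fun_upd_apply)
  with Cons.IH Cons.prems(1) X Y show ?case
    by auto
qed

lemma set_etree_Lred: "set_etree (Lred a X) \<subseteq> set_etree X - {a}"
  by (induction X) auto

lemma set_etree_Rred: "set_etree (Rred a X) \<subseteq> set_etree X - {a}"
  by (induction X) auto

lemma Lred_id: "a \<notin> set_etree X \<Longrightarrow> Lred a X = X"
  by (induction X) auto

lemma Rred_id: "a \<notin> set_etree X \<Longrightarrow> Rred a X = X"
  by (induction X) auto

lemma Lred_replace_leaves:
  "Lred a (replace_leaves X Y Z) = replace_leaves (Lred a X) (Lred a Y) (Lred a Z)"
  by (induction X) auto

lemma Rred_replace_leaves: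
  "Rred a (replace_leaves X Y Z) = replace_leaves (Rred a X) (Rred a Y) (Rred a Z)"
  by (induction X) auto

lemma set_etree_replace_leaves:
  "set_etree (replace_leaves X Y Z) \<subseteq> set_etree X \<union> set_etree Y \<union> set_etree Z"
  by (induction X) auto

lemma set_etree_E_term: "set_etree (se (E_term \<rho>)) = set \<rho>"
  by (induction \<rho>) auto

text \<open>Memorising the root query \<open>a\<close> leaves the rest of \<open>E_term\<close>
  intact, since \<open>a\<close> is not in \<open>\<rho>\<close>, and only prunes \<open>X\<close>.
  Each branch thus has the same form, with \<open>Lred a X\<close> or \<open>Rred a X\<close> over
  the shorter list.\<close>

lemma complete_memo:
  "\<lbrakk>distinct \<rho>; set_etree X \<subseteq> set \<rho>\<rbrakk>
    \<Longrightarrow> complete \<rho> (memo (replace_leaves (se (E_term \<rho>)) TLeaf X))"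
proof (induction \<rho> arbitrary: X)
  case Nil
  then show ?case
    \<comment> \<open>Without atoms, \<open>X\<close> is a leaf.\<close>
    by (cases X) auto
next
  case (Cons a \<rho>)
  then have "set_etree (Lred a X) \<subseteq> set \<rho>" "set_etree (Rred a X) \<subseteq> set \<rho>"
    using set_etree_Lred[of a X] set_etree_Rred[of a X] by auto
  with Cons show ?case
    by (simp add: Lred_replace_leaves Rred_replace_leaves Lred_id Rred_id set_etree_E_term)
qed

lemma set_etree_transl: "P \<in> SP \<sigma> \<Longrightarrow> set_etree (se (transl P)) \<subseteq> set \<sigma>"
  by (induction rule: SP.induct) (use set_etree_replace_leaves in fastforce)+

lemma complete_sse: "\<lbrakk>distinct \<sigma>; P \<in> SP \<sigma>\<rbrakk> \<Longrightarrow> complete \<sigma> (sse \<sigma> (transl P))"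
  by (simp add: sse_def mse_def complete_memo set_etree_transl)

lemma sse_eq_iff_eval_eq:
  assumes "distinct \<sigma>" "P \<in> SP \<sigma>" "Q \<in> SP \<sigma>"
  shows "sse_eq \<sigma> P Q \<longleftrightarrow> (\<forall>v. eval w v P = eval w v Q)"
proof
  assume "sse_eq \<sigma> P Q"
  with assms show "\<forall>v. eval w v P = eval w v Q"
    by (metis sse_eq_def teval_sse)
next
  assume "\<forall>v. eval w v P = eval w v Q"
  with assms show "sse_eq \<sigma> P Q"
    unfolding sse_eq_def
    by (intro complete_eq_if_teval_eq[of \<sigma>]) (simp_all add: complete_sse teval_sse[where w = w])
qed

theorem theorem6p11:
  fixes \<sigma> :: "'a list"
  assumes "distinct \<sigma>"
  shows "\<forall>P \<in> SP \<sigma>. \<forall>Q \<in> SP \<sigma>. EqSSCL \<turnstile> P \<approx> Q \<longleftrightarrow> sse_eq \<sigma> P Q"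
  \<comment> \<open>Terms in \<open>SP \<sigma>\<close> have no variables, so any \<open>w\<close>
    serves; fixing the same one makes the two truth-table conditions identical.\<close>
  using assms derivable_iff_eval_eq[where w = "\<lambda>_. False"]
    sse_eq_iff_eval_eq[where w = "\<lambda>_. False"] by blast

end
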